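(* Let $p\in(0,1)$, let $m\le n$ be positive integers, and let $k$ be an integer with $1\le k\le m$. Let $\mathcal{A}:\mathbb{R}^{m\times n}\to\mathbb{R}^l$ be a given linear operator. Then every matrix $\bar{X}\in\mathbb{R}^{m\times n}$ with $\mathrm{rank}(\bar{X})\le k$ and $y=\mathcal{A}(\bar{X})\in\mathbb{R}^l$ can be exactly recovered by solving $$\text{minimize } \|X\|_p^p \quad\text{subject to } \mathcal{A}(X)=y,\; X\in\mathbb{R}^{m\times n}$$ if and only if $$\sum_{i=1}^k\sigma_i^p(Z)<\sum_{i=k+1}^m\sigma_i^p(Z)$$ holds for all $Z\in\mathcal{N}(\mathcal{A})\setminus\{\mathbf{0}\}$.
   Context: For a matrix $X\in\mathbb{R}^{m\times n}$ with $m\le n$, $\sigma_i(X)$ is the $i$-th largest singular value, $\sigma_i^p(X)=(\sigma_i(X))^p$, and $\|X\|_p^p=\sum_{i=1}^{m}\sigma_i^p(X)$. $\mathcal{N}(\mathcal{A})=\{Z\in\mathbb{R}^{m\times n}:\mathcal{A}(Z)=\mathbf{0}\}$ is the nullspace of $\mathcal{A}$. "Exactly recovered by solving" the optimization problem means that $\bar{X}$ is the unique optimal solution of that problem (with $y=\mathcal{A}(\bar X)$). *)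

theory Defs
  imports
    "HOL-Analysis.Analysis"
    "HOL-Computational_Algebra.Polynomial"
    "HOL-Library.Multiset"
begin

definition charpoly :: "'a::comm_ring_1^'m^'m \<Rightarrow> 'a poly" where
  "charpoly A = det (\<chi> i j. (if i = j then [:0, 1:] else 0) - [:A $ i $ j:])"

text \<open>The eigenvalues of \<open>X X\<^sup>T\<close> with their algebraic multiplicities. For a matrix with
  \<open>m \<le> n\<close> rows this is the Gram matrix of size \<open>m\<close>, whose \<open>m\<close> eigenvalues (all real and
  nonnegative) are the squares of the \<open>m\<close> singular values.\<close>

definition gram_eigenvalues :: "real^'n^'m \<Rightarrow> real multiset" where
  "gram_eigenvalues X = proots (charpoly (X ** transpose X))"

text \<open>The \<open>i\<close>-th largest singular value, counted from \<open>1\<close>: meaningful for \<open>1 \<le> i \<le> m\<close>.\<close>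

definition singular_value :: "nat \<Rightarrow> real^'n^'m \<Rightarrow> real" where
  "singular_value i X = sqrt (rev (sorted_list_of_multiset (gram_eigenvalues X)) ! (i - 1))"

text \<open>\<open>\<parallel>X\<parallel>\<^sub>p\<^sup>p\<close>; note that \<open>0 powr p = 0\<close>.\<close>

definition schatten_pow :: "real \<Rightarrow> real^'n^'m \<Rightarrow> real" where
  "schatten_pow p X = (\<Sum>i = 1..CARD('m). singular_value i X powr p)"

definition optimal_solution ::
    "real \<Rightarrow> (real^'n^'m \<Rightarrow> real^'l) \<Rightarrow> real^'l \<Rightarrow> real^'n^'m \<Rightarrow> bool" where
  "optimal_solution p \<A> y = is_arg_min (schatten_pow p) (\<lambda>X. \<A> X = y)"

definition exactly_recovered ::
    "real \<Rightarrow> (real^'n^'m \<Rightarrow> real^'l) \<Rightarrow> real^'n^'m \<Rightarrow> bool" where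
  "exactly_recovered p \<A> X \<longleftrightarrow> (\<forall>W. optimal_solution p \<A> (\<A> X) W \<longleftrightarrow> W = X)"

definition nullspace :: "(real^'n^'m \<Rightarrow> real^'l) \<Rightarrow> (real^'n^'m) set" where
  "nullspace \<A> = {Z. \<A> Z = 0}"

end

theory Submission imports Defs begin

text \<open>The heart of the matter is the concave Mirsky inequality
  \<open>\<Sum>\<^sub>i \<bar>\<sigma>\<^sub>i(A)\<^sup>p - \<sigma>\<^sub>i(B)\<^sup>p\<bar> \<le> \<parallel>B - A\<parallel>\<^sub>p\<^sup>p\<close>. By the triangle inequality and the singular value
  decomposition of \<open>B - A\<close>, it suffices to treat a rank-one difference \<open>u w\<^sup>T\<close> with \<open>\<bar>u\<bar> = 1\<close>. Then the
  singular values of \<open>A\<close> and \<open>B\<close> interlace, so the intervals between \<open>\<sigma>\<^sub>i(A)\<close> and \<open>\<sigma>\<^sub>i(B)\<close> do not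
  overlap, and their total length is at most \<open>\<bar>w\<bar>\<close>: the dilations of \<open>A\<close> and \<open>B\<close> have a common
  symmetric upper bound of trace \<open>\<bar>w\<bar>\<close>. Concavity of \<open>t\<^sup>p\<close> then bounds the sum by \<open>\<bar>w\<bar>\<^sup>p\<close>.
  Applied to \<open>-Z\<close> and \<open>X\<close> with \<open>rank X \<le> k\<close>, the inequality gives recovery of \<open>X\<close> under the
  nullspace condition; conversely, splitting the singular value decomposition of \<open>Z\<close> after the
  \<open>k\<close>-th term yields \<open>X - W = Z\<close> with \<open>rank X \<le> k\<close>, and recovery of \<open>X\<close> forces
  \<open>\<parallel>X\<parallel>\<^sub>p\<^sup>p < \<parallel>W\<parallel>\<^sub>p\<^sup>p\<close>.\<close>

subsection \<open>Symmetric operators\<close>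

text \<open>The subspaces in the min-max arguments are orthogonal complements of finite sets.
  Intersecting them means uniting the sets, so counting vectors replaces dimension formulas.\<close>

lemma exists_nonzero_orthogonal:
  fixes F :: "'a::euclidean_space set"
  assumes "finite F" "card F < DIM('a)"
  obtains x where "x \<noteq> 0" "\<And>f. f \<in> F \<Longrightarrow> x \<bullet> f = 0"
proof -
  have "dim F < DIM('a)" using assms dim_le_card'[of F] by simp
  then obtain x where "x \<noteq> 0" "\<And>y. y \<in> span F \<Longrightarrow> orthogonal x y"
    using orthogonal_to_subspace_exists by metis
  then show ?thesis using that by (meson orthogonal_def span_base)
qed

definition orthonormal_upto :: "nat \<Rightarrow> (nat \<Rightarrow> 'a::real_inner) \<Rightarrow> bool" where
  "orthonormal_upto n f \<longleftrightarrow> (\<forall>i<n. \<forall>j<n. f i \<bullet> f j = (if i = j then 1 else 0))"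

lemma orthonormal_uptoD:
  "orthonormal_upto n f \<Longrightarrow> i < n \<Longrightarrow> j < n \<Longrightarrow> f i \<bullet> f j = (if i = j then 1 else 0)"
  by (simp add: orthonormal_upto_def)

text \<open>A nonzero residual of the expansion would be orthogonal to every \<open>f i\<close> and
  so give one more independent vector than the dimension allows.\<close>

lemma orthonormal_expansion:
  fixes f :: "nat \<Rightarrow> 'a::euclidean_space"
  assumes f: "orthonormal_upto DIM('a) f"
  shows "x = (\<Sum>j<DIM('a). (x \<bullet> f j) *\<^sub>R f j)"
proof (rule ccontr)
  define z where "z = x - (\<Sum>j<DIM('a). (x \<bullet> f j) *\<^sub>R f j)"
  assume "\<not> ?thesis"
  then have "z \<noteq> 0" by (simp add: z_def)
  have zf: "z \<bullet> f i = 0" if "i < DIM('a)" for i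
  proof -
    have "(\<Sum>j<DIM('a). (x \<bullet> f j) * (f j \<bullet> f i)) = (\<Sum>j<DIM('a). if i = j then x \<bullet> f j else 0)"
      by (rule sum.cong) (auto simp: orthonormal_uptoD[OF f] that)
    then show ?thesis using that by (simp add: z_def inner_diff_left inner_sum_left)
  qed
  have inj: "inj_on f {..<DIM('a)}"
    by (rule inj_onI) (metis f lessThan_iff orthonormal_uptoD zero_neq_one)
  have znf: "z \<notin> f ` {..<DIM('a)}"
    using zf \<open>z \<noteq> 0\<close> by (metis imageE inner_eq_zero_iff lessThan_iff)
  have "pairwise orthogonal (insert z (f ` {..<DIM('a)}))"
    using zf by (auto simp: pairwise_def orthogonal_def orthonormal_uptoD[OF f] inner_commute)
  moreover have "0 \<notin> insert z (f ` {..<DIM('a)})"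
    using \<open>z \<noteq> 0\<close> orthonormal_uptoD[OF f] by fastforce
  ultimately have "independent (insert z (f ` {..<DIM('a)}))"
    by (rule pairwise_orthogonal_independent)
  then have "card (insert z (f ` {..<DIM('a)})) \<le> DIM('a)"
    using independent_card_le by blast
  then show False using znf inj by (simp add: card_image)
qed

lemma orthonormal_inner:
  fixes f :: "nat \<Rightarrow> 'a::euclidean_space"
  assumes f: "orthonormal_upto DIM('a) f"
  shows "x \<bullet> y = (\<Sum>j<DIM('a). (x \<bullet> f j) * (y \<bullet> f j))"
proof -
  have "x \<bullet> y = (\<Sum>j<DIM('a). (x \<bullet> f j) *\<^sub>R f j) \<bullet> y"
    using orthonormal_expansion[OF f] by metis
  then show ?thesis by (simp add: inner_sum_left inner_commute[of y])
qed

text \<open>Each new eigenvector maximises the quadratic form on the orthogonal complement of the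
  previous ones, so the eigenvalues come out in decreasing order.\<close>

lemma spectral_upto:
  fixes T :: "'a::euclidean_space \<Rightarrow> 'a"
  assumes "linear T" and sym: "\<And>x y. x \<bullet> T y = T x \<bullet> y" and "n \<le> DIM('a)"
  shows "\<exists>f \<mu>. orthonormal_upto n f \<and> (\<forall>j<n. T (f j) = \<mu> j *\<^sub>R f j) \<and>
    (\<forall>j<n. \<forall>x. (\<forall>i<j. x \<bullet> f i = 0) \<longrightarrow> x \<bullet> T x \<le> \<mu> j * (x \<bullet> x))"
  using \<open>n \<le> DIM('a)\<close>
proof (induction n)
  case 0
  then show ?case by (simp add: orthonormal_upto_def)
next
  case (Suc n)
  then obtain f \<mu> where f: "orthonormal_upto n f" and Tf: "\<And>j. j < n \<Longrightarrow> T (f j) = \<mu> j *\<^sub>R f j"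
    and max: "\<And>j x. j < n \<Longrightarrow> \<forall>i<j. x \<bullet> f i = 0 \<Longrightarrow> x \<bullet> T x \<le> \<mu> j * (x \<bullet> x)"
    by (metis Suc_leD)
  interpret T: linear T by fact
  define S where "S = {x. \<forall>i<n. x \<bullet> f i = 0}"
  have S_lin: "a *\<^sub>R x + b *\<^sub>R y \<in> S" if "x \<in> S" "y \<in> S" for a b x y
    using that by (auto simp: S_def inner_add_left)
  have "card (f ` {..<n}) \<le> n" using card_image_le[of "{..<n}" f] by simp
  then have "card (f ` {..<n}) < DIM('a)" using Suc.prems by linarith
  then obtain x0 where x0: "x0 \<noteq> 0" and "\<And>g. g \<in> f ` {..<n} \<Longrightarrow> x0 \<bullet> g = 0"
    using exists_nonzero_orthogonal[of "f ` {..<n}"] by blast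
  then have x0S: "x0 \<in> S" by (simp add: S_def)
  have "closed S"
  proof -
    have "S = (\<Inter>i\<in>{..<n}. {x. x \<bullet> f i = 0})" by (auto simp: S_def)
    moreover have "closed {x. x \<bullet> f i = 0}" for i
      using closed_hyperplane[of "f i" 0] by (simp add: inner_commute)
    ultimately show ?thesis by (auto intro!: closed_INT)
  qed
  then have "compact (sphere 0 1 \<inter> S)" by (simp add: compact_Int_closed)
  moreover have "(1 / norm x0) *\<^sub>R x0 \<in> sphere 0 1 \<inter> S"
    using x0 x0S S_lin[of x0 x0 "1 / norm x0" 0] by simp
  moreover have "continuous_on (sphere 0 1 \<inter> S) (\<lambda>x. x \<bullet> T x)"
    by (intro continuous_on_inner continuous_on_id linear_continuous_on
        linear_conv_bounded_linear[THEN iffD1] \<open>linear T\<close>)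
  ultimately obtain e where e: "e \<in> sphere 0 1 \<inter> S"
    and emax: "\<And>x. x \<in> sphere 0 1 \<inter> S \<Longrightarrow> x \<bullet> T x \<le> e \<bullet> T e"
    using continuous_attains_sup[of "sphere 0 1 \<inter> S" "\<lambda>x. x \<bullet> T x"] by blast
  define m where "m = e \<bullet> T e"
  have ee: "e \<bullet> e = 1" and eS: "e \<in> S"
    using e by (auto simp: norm_eq_1)
  have bound: "x \<bullet> T x \<le> m * (x \<bullet> x)" if "x \<in> S" for x
  proof (cases "x = 0")
    case False
    have "(1 / norm x) *\<^sub>R x \<in> sphere 0 1 \<inter> S"
      using that False S_lin[of x x "1 / norm x" 0] by simp
    from emax[OF this] have "(x \<bullet> T x) / (norm x * norm x) \<le> m"
      by (simp add: T.scaleR m_def)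
    then show ?thesis using False by (simp add: dot_square_norm power2_eq_square divide_simps mult_ac)
  qed simp
  \<comment> \<open>The residual \<open>y\<close> measures how far \<open>e\<close> is from being an
    eigenvector. Symmetry of \<open>T\<close> keeps it in \<open>S\<close>, so it is an admissible
    direction for perturbing the maximiser \<open>e\<close>.\<close>
  define y where "y = T e - m *\<^sub>R e"
  have "T e \<in> S"
    using eS by (auto simp: S_def Tf simp flip: sym)
  then have yS: "y \<in> S" using S_lin[OF _ eS, of "T e" 1 "- m"] by (simp add: y_def)
  define c where "c = y \<bullet> T y - m * (y \<bullet> y)"
  have quad: "2 * t * (y \<bullet> y) + t\<^sup>2 * c \<le> 0" for t
  proof -
    have "(e + t *\<^sub>R y) \<bullet> T (e + t *\<^sub>R y) \<le> m * ((e + t *\<^sub>R y) \<bullet> (e + t *\<^sub>R y))"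
      using bound[OF S_lin[OF eS yS, of 1 t]] by simp
    moreover have "e \<bullet> T y = y \<bullet> T e" using sym[of e y] by (simp add: inner_commute)
    ultimately have "2 * t * (y \<bullet> T e - m * (y \<bullet> e)) + t\<^sup>2 * c \<le> 0"
      by (simp add: T.add T.scaleR inner_add_left inner_add_right algebra_simps c_def
          power2_eq_square ee m_def[symmetric] inner_commute)
    moreover have "y \<bullet> T e - m * (y \<bullet> e) = y \<bullet> y"
      by (simp add: y_def inner_diff_right)
    ultimately show ?thesis by simp
  qed
  have "y \<bullet> y \<le> 0"
  proof (rule ccontr)
    assume pos: "\<not> y \<bullet> y \<le> 0"
    \<comment> \<open>So small a step makes the term linear in \<open>t\<close> outweigh the
      quadratic one.\<close>
    define t where "t = (y \<bullet> y) / (\<bar>c\<bar> + 1)"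
    have t: "t > 0" unfolding t_def by (rule divide_pos_pos) (use pos in linarith)+
    have "t * (2 * (y \<bullet> y) + t * c) \<le> 0" using quad[of t]
      by (simp add: power2_eq_square algebra_simps)
    then have "2 * (y \<bullet> y) + t * c \<le> 0" using t by (simp add: mult_le_0_iff)
    moreover have "t * c \<ge> - (t * (\<bar>c\<bar> + 1))"
      using t by (smt (verit) mult_left_mono mult_minus_right)
    moreover have "t * (\<bar>c\<bar> + 1) = y \<bullet> y" by (simp add: t_def)
    ultimately show False using pos by linarith
  qed
  then have "y = 0" by (metis inner_eq_zero_iff inner_ge_zero order_antisym)
  then have Te: "T e = m *\<^sub>R e" by (simp add: y_def)
  have "e \<bullet> f i = 0" "f i \<bullet> e = 0" if "i < n" for i
    using eS that by (auto simp: S_def inner_commute)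
  then have "orthonormal_upto (Suc n) (f(n := e))"
    using f ee by (auto simp: orthonormal_upto_def less_Suc_eq)
  moreover have "\<forall>j<Suc n. T ((f(n := e)) j) = (\<mu>(n := m)) j *\<^sub>R (f(n := e)) j"
    using Tf Te by (auto simp: less_Suc_eq)
  moreover have "\<forall>j<Suc n. \<forall>x. (\<forall>i<j. x \<bullet> (f(n := e)) i = 0) \<longrightarrow>
      x \<bullet> T x \<le> (\<mu>(n := m)) j * (x \<bullet> x)"
    using max bound by (auto simp: less_Suc_eq S_def)
  ultimately show ?case by blast
qed

text \<open>No order is imposed on the eigenvalues, because truncating a singular value
  decomposition can leave zeros at arbitrary places.\<close>

definition eigensystem :: "('a::euclidean_space \<Rightarrow> 'a) \<Rightarrow> (nat \<Rightarrow> 'a) \<Rightarrow> (nat \<Rightarrow> real) \<Rightarrow> bool" where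
  "eigensystem T f \<mu> \<longleftrightarrow> orthonormal_upto DIM('a) f \<and> (\<forall>j<DIM('a). T (f j) = \<mu> j *\<^sub>R f j)"

theorem spectral:
  fixes T :: "'a::euclidean_space \<Rightarrow> 'a"
  assumes "linear T" and sym: "\<And>x y. x \<bullet> T y = T x \<bullet> y"
  obtains f \<mu> where "eigensystem T f \<mu>" "\<And>i j. i \<le> j \<Longrightarrow> j < DIM('a) \<Longrightarrow> \<mu> j \<le> \<mu> i"
proof -
  obtain f \<mu> where f: "orthonormal_upto DIM('a) f"
    and Tf: "\<And>j. j < DIM('a) \<Longrightarrow> T (f j) = \<mu> j *\<^sub>R f j"
    and max: "\<And>j x. j < DIM('a) \<Longrightarrow> (\<And>i. i < j \<Longrightarrow> x \<bullet> f i = 0) \<Longrightarrow> x \<bullet> T x \<le> \<mu> j * (x \<bullet> x)"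
    using spectral_upto[OF assms order_refl] by metis
  have "\<mu> j \<le> \<mu> i" if "i \<le> j" "j < DIM('a)" for i j
  proof -
    have "f j \<bullet> T (f j) \<le> \<mu> i * (f j \<bullet> f j)"
      using that by (intro max) (auto simp: orthonormal_uptoD[OF f])
    then show ?thesis using that by (simp add: Tf orthonormal_uptoD[OF f])
  qed
  with f Tf show ?thesis using that unfolding eigensystem_def by blast
qed

lemma eigensystem_form:
  fixes T :: "'a::euclidean_space \<Rightarrow> 'a"
  assumes "eigensystem T f \<mu>" and "linear T"
  shows "x \<bullet> T x = (\<Sum>j<DIM('a). \<mu> j * (x \<bullet> f j)\<^sup>2)"
proof -
  interpret T: linear T by fact
  have f: "orthonormal_upto DIM('a) f" using assms by (simp add: eigensystem_def)
  have "T x = T (\<Sum>j<DIM('a). (x \<bullet> f j) *\<^sub>R f j)"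
    using orthonormal_expansion[OF f] by metis
  also have "\<dots> = (\<Sum>j<DIM('a). (x \<bullet> f j) *\<^sub>R T (f j))"
    by (simp add: T.sum T.scaleR)
  also have "\<dots> = (\<Sum>j<DIM('a). (x \<bullet> f j) *\<^sub>R \<mu> j *\<^sub>R f j)"
    using assms by (intro sum.cong) (auto simp: eigensystem_def)
  finally show ?thesis by (simp add: inner_sum_right power2_eq_square mult_ac)
qed

section \<open>Min-max bounds and the trace\<close>

text \<open>One half of the min-max principle: \<open>x\<close> has no component along the first
  \<open>i\<close> eigenvectors, and the remaining eigenvalues are at most
  \<open>\<mu> i\<close>.\<close>

lemma eigensystem_form_le:
  fixes T :: "'a::euclidean_space \<Rightarrow> 'a"
  assumes "eigensystem T f \<mu>" "linear T"
    and dec: "\<And>i j. i \<le> j \<Longrightarrow> j < DIM('a) \<Longrightarrow> \<mu> j \<le> \<mu> i"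
    and "\<And>j. j < i \<Longrightarrow> x \<bullet> f j = 0"
  shows "x \<bullet> T x \<le> \<mu> i * (x \<bullet> x)"
proof -
  have f: "orthonormal_upto DIM('a) f" using assms by (simp add: eigensystem_def)
  have "\<mu> j * (x \<bullet> f j)\<^sup>2 \<le> \<mu> i * (x \<bullet> f j)\<^sup>2" if "j < DIM('a)" for j
    using assms(4)[of j] dec[of i j] that by (cases "j < i") (auto intro: mult_right_mono)
  then have "(\<Sum>j<DIM('a). \<mu> j * (x \<bullet> f j)\<^sup>2) \<le> (\<Sum>j<DIM('a). \<mu> i * (x \<bullet> f j)\<^sup>2)"
    by (intro sum_mono) auto
  then show ?thesis
    using eigensystem_form[OF assms(1,2), of x] orthonormal_inner[OF f, of x x]
    by (simp add: sum_distrib_left power2_eq_square)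
qed

lemma eigensystem_form_ge:
  fixes T :: "'a::euclidean_space \<Rightarrow> 'a"
  assumes "eigensystem T f \<mu>" "linear T"
    and dec: "\<And>i j. i \<le> j \<Longrightarrow> j < DIM('a) \<Longrightarrow> \<mu> j \<le> \<mu> i"
    and i: "i < DIM('a)" and "\<And>j. i < j \<Longrightarrow> j < DIM('a) \<Longrightarrow> x \<bullet> f j = 0"
  shows "\<mu> i * (x \<bullet> x) \<le> x \<bullet> T x"
proof -
  have f: "orthonormal_upto DIM('a) f" using assms by (simp add: eigensystem_def)
  have "\<mu> i * (x \<bullet> f j)\<^sup>2 \<le> \<mu> j * (x \<bullet> f j)\<^sup>2" if "j < DIM('a)" for j
    using assms(5)[of j] dec[of j i] that i by (cases "i < j") (auto intro: mult_right_mono)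
  then have "(\<Sum>j<DIM('a). \<mu> i * (x \<bullet> f j)\<^sup>2) \<le> (\<Sum>j<DIM('a). \<mu> j * (x \<bullet> f j)\<^sup>2)"
    by (intro sum_mono) auto
  then show ?thesis
    using eigensystem_form[OF assms(1,2), of x] orthonormal_inner[OF f, of x x]
    by (simp add: sum_distrib_left power2_eq_square)
qed

text \<open>After exchanging the sums, the coefficient of each eigenvalue is the squared length of
  its unit eigenvector.\<close>

lemma eigensystem_trace:
  fixes T :: "'a::euclidean_space \<Rightarrow> 'a"
  assumes "eigensystem T f \<mu>" "linear T"
  shows "(\<Sum>j<DIM('a). \<mu> j) = (\<Sum>b\<in>Basis. b \<bullet> T b)"
proof -
  have f: "orthonormal_upto DIM('a) f" using assms by (simp add: eigensystem_def)
  have "(\<Sum>b\<in>Basis. b \<bullet> T b) = (\<Sum>j<DIM('a). \<mu> j * (\<Sum>b\<in>Basis. (f j \<bullet> b) * (f j \<bullet> b)))"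
    by (simp add: eigensystem_form[OF assms] sum_distrib_left power2_eq_square inner_commute)
      (rule sum.swap)
  also have "\<dots> = (\<Sum>j<DIM('a). \<mu> j * (f j \<bullet> f j))"
    by (simp flip: euclidean_inner)
  also have "\<dots> = (\<Sum>j<DIM('a). \<mu> j)"
    by (rule sum.cong) (auto simp: orthonormal_uptoD[OF f])
  finally show ?thesis by simp
qed

subsection \<open>Singular values\<close>

lemma poly_det: "poly (det A) x = det (\<chi> i j. poly (A $ i $ j) x)"
  by (simp add: det_def poly_sum poly_prod sign_def)

lemma poly_charpoly: "poly (charpoly A) x = det (mat x - A)"
  unfolding charpoly_def poly_det by (intro arg_cong[of _ _ det]) (auto simp: vec_eq_iff mat_def)

text \<open>The eigenvectors form the columns of an orthogonal matrix \<open>Q\<close>, which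
  diagonalises \<open>mat x - M\<close>; cancelling \<open>det Q\<close> compares the two
  polynomials at every \<open>x\<close>. The bijection \<open>h\<close> numbers the index
  type.\<close>

lemma charpoly_eigenbasis:
  fixes M :: "real^'m^'m" and h :: "'m \<Rightarrow> nat"
  assumes e: "eigensystem ((*v) M) e \<mu>" and h: "bij_betw h UNIV {..<CARD('m)}"
  shows "charpoly M = (\<Prod>i\<in>UNIV. [:- \<mu> (h i), 1:])"
proof -
  have on: "orthonormal_upto CARD('m) e" and eig: "\<And>j. j < CARD('m) \<Longrightarrow> M *v e j = \<mu> j *\<^sub>R e j"
    using e by (auto simp: eigensystem_def)
  have hl: "h i < CARD('m)" for i using h by (auto simp: bij_betw_def)
  have hi: "h i = h j \<longleftrightarrow> i = j" for i j using h by (auto simp: bij_betw_def inj_on_def)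
  define Q :: "real^'m^'m" where "Q = (\<chi> i j. e (h j) $ i)"
  have "transpose Q ** Q = mat 1"
    by (simp add: vec_eq_iff matrix_matrix_mult_def transpose_def Q_def mat_def hi hl
        orthonormal_uptoD[OF on, unfolded inner_vec_def, simplified])
  then have "det Q * det Q = 1"
    by (metis det_I det_mul det_transpose)
  then have Q: "det Q \<noteq> 0" by auto
  have "poly (charpoly M) x = poly (\<Prod>i\<in>UNIV. [:- \<mu> (h i), 1:]) x" for x
  proof -
    define D :: "real^'m^'m" where "D = (\<chi> i j. if i = j then x - \<mu> (h i) else 0)"
    have "(mat x - M) ** Q = Q ** D"
    proof -
      have "(M *v e (h j)) $ i = \<mu> (h j) * e (h j) $ i" for i j
        by (simp add: eig hl)
      then have "(\<Sum>k\<in>UNIV. M $ i $ k * e (h j) $ k) = \<mu> (h j) * e (h j) $ i" for i j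
        by (simp add: matrix_vector_mult_def)
      then have "M ** Q = (\<chi> i j. \<mu> (h j) * e (h j) $ i)"
        by (simp add: vec_eq_iff matrix_matrix_mult_def Q_def)
      moreover have "(mat x - M) ** Q = mat x ** Q - M ** Q"
        by (simp add: vec_eq_iff matrix_matrix_mult_def left_diff_distrib sum_subtractf)
      moreover have "mat x ** Q = (\<chi> i j. x * e (h j) $ i)"
        by (simp add: vec_eq_iff matrix_matrix_mult_def mat_def Q_def if_distrib[of "\<lambda>c. c * _"] cong: if_cong)
      moreover have "Q ** D = (\<chi> i j. e (h j) $ i * (x - \<mu> (h j)))"
        by (simp add: vec_eq_iff matrix_matrix_mult_def D_def Q_def if_distrib cong: if_cong)
      ultimately show ?thesis by (simp add: vec_eq_iff right_diff_distrib mult.commute)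
    qed
    then have "det (mat x - M) * det Q = det Q * det D" by (metis det_mul)
    then have "det (mat x - M) = det D" using Q by simp
    also have "\<dots> = (\<Prod>i\<in>UNIV. x - \<mu> (h i))"
      by (subst det_diagonal) (auto simp: D_def)
    finally show ?thesis by (simp add: poly_charpoly poly_prod)
  qed
  then show ?thesis by (simp add: poly_eq_poly_eq_iff[symmetric] fun_eq_iff)
qed

text \<open>Here the definition through polynomial roots meets the spectral theorem: any orthonormal
  eigenbasis lists the roots with their multiplicities.\<close>

lemma proots_charpoly:
  fixes M :: "real^'m^'m"
  assumes e: "eigensystem ((*v) M) e \<mu>"
  shows "proots (charpoly M) = mset (map \<mu> [0..<CARD('m)])"
proof -
  obtain h :: "'m \<Rightarrow> nat" where h: "bij_betw h UNIV {..<CARD('m)}"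
    using ex_bij_betw_finite_nat[OF finite_class.finite_UNIV] by (metis atLeast0LessThan)
  have "proots (charpoly M) = (\<Sum>i\<in>UNIV. {#\<mu> (h i)#})"
    unfolding charpoly_eigenbasis[OF e h] by (subst proots_prod) auto
  also have "\<dots> = (\<Sum>j<CARD('m). {#\<mu> j#})"
    using sum.reindex_bij_betw[OF h, of "\<lambda>j. {#\<mu> j#}"] by simp
  also have "\<dots> = mset (map \<mu> [0..<n])" if "n = CARD('m)" for n
    unfolding that[symmetric] by (induction n) auto
  finally show ?thesis by simp
qed

section \<open>Gram matrices and left singular bases\<close>

lemma linear_matrix_vector: "linear ((*v) (A :: real^'n^'m))"
  by simp

text \<open>With equal arguments, this turns the Gram form into the squared length of
  \<open>transpose X *v x\<close>.\<close>

lemma gram_inner: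
  fixes X :: "real^'n^'m"
  shows "x \<bullet> ((X ** transpose X) *v y) = (transpose X *v x) \<bullet> (transpose X *v y)"
  by (metis dot_lmul_matrix matrix_vector_mul_assoc transpose_matrix_vector)

lemma gram_eigenvalue_nonneg:
  fixes X :: "real^'n^'m"
  assumes "eigensystem ((*v) (X ** transpose X)) e \<mu>" "j < CARD('m)"
  shows "0 \<le> \<mu> j"
proof -
  have "e j \<bullet> ((X ** transpose X) *v e j) = \<mu> j"
    using assms by (simp add: eigensystem_def orthonormal_upto_def)
  then show ?thesis unfolding gram_inner by (metis inner_ge_zero)
qed

text \<open>Only the order has to be matched: a decreasing list of eigenvalues is the reverse of the
  sorted one. \<open>Suc j\<close> bridges counting from 0 and counting from 1.\<close>

lemma singular_value_eigensystem:
  fixes X :: "real^'n^'m"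
  assumes e: "eigensystem ((*v) (X ** transpose X)) e \<mu>"
    and dec: "\<And>i j. i \<le> j \<Longrightarrow> j < CARD('m) \<Longrightarrow> \<mu> j \<le> \<mu> i"
    and j: "j < CARD('m)"
  shows "singular_value (Suc j) X = sqrt (\<mu> j)"
proof -
  have "sorted (rev (map \<mu> [0..<CARD('m)]))"
    unfolding sorted_wrt_rev by (auto simp: sorted_wrt_iff_nth_less dec)
  then have "sort (map \<mu> [0..<CARD('m)]) = rev (map \<mu> [0..<CARD('m)])"
    by (metis mset_rev properties_for_sort)
  then have "rev (sorted_list_of_multiset (gram_eigenvalues X)) = map \<mu> [0..<CARD('m)]"
    unfolding gram_eigenvalues_def proots_charpoly[OF e] sorted_list_of_multiset_mset by simp
  then show ?thesis using j by (simp add: singular_value_def)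
qed

text \<open>The sum depends only on the multiset of eigenvalues, so no order on \<open>\<mu>\<close>
  is assumed.\<close>

lemma schatten_pow_eigensystem:
  fixes X :: "real^'n^'m"
  assumes e: "eigensystem ((*v) (X ** transpose X)) e \<mu>"
  shows "schatten_pow p X = (\<Sum>j<CARD('m). sqrt (\<mu> j) powr p)"
proof -
  define l where "l = rev (sorted_list_of_multiset (gram_eigenvalues X))"
  have l: "mset l = mset (map \<mu> [0..<CARD('m)])"
    unfolding l_def gram_eigenvalues_def proots_charpoly[OF e] by simp
  then have len: "length l = CARD('m)" by (metis length_map length_upt mset_eq_length diff_zero)
  have "schatten_pow p X = (\<Sum>j<CARD('m). sqrt (l ! j) powr p)"
    unfolding schatten_pow_def singular_value_def l_def
    by (rule sum.reindex_bij_witness[of _ Suc "\<lambda>i. i - 1"]) auto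
  also have "\<dots> = sum_list (map (\<lambda>t. sqrt t powr p) l)"
    by (simp add: sum_list_sum_nth len atLeast0LessThan)
  also have "\<dots> = sum_mset (image_mset (\<lambda>t. sqrt t powr p) (mset l))"
    by (simp flip: sum_mset_sum_list)
  also have "\<dots> = sum_list (map (\<lambda>t. sqrt t powr p) (map \<mu> [0..<CARD('m)]))"
    unfolding l by (simp add: multiset.map_comp flip: sum_mset_sum_list)
  also have "\<dots> = (\<Sum>j<CARD('m). sqrt (\<mu> j) powr p)"
    by (simp add: sum_list_sum_nth atLeast0LessThan)
  finally show ?thesis .
qed

lemma schatten_pow_lessThan:
  "schatten_pow p (X :: real^'n^'m) = (\<Sum>j<CARD('m). singular_value (Suc j) X powr p)"
  unfolding schatten_pow_def by (rule sum.reindex_bij_witness[of _ Suc "\<lambda>i. i - 1"]) auto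

definition left_singular_basis :: "real^'n^'m \<Rightarrow> (nat \<Rightarrow> real^'m) \<Rightarrow> bool" where
  "left_singular_basis X u \<longleftrightarrow>
    eigensystem ((*v) (X ** transpose X)) u (\<lambda>j. (singular_value (Suc j) X)\<^sup>2)"

lemma singular_values:
  fixes X :: "real^'n^'m"
  obtains u where "left_singular_basis X u"
    and "\<And>j. j < CARD('m) \<Longrightarrow> 0 \<le> singular_value (Suc j) X"
    and "\<And>i j. i \<le> j \<Longrightarrow> j < CARD('m) \<Longrightarrow> singular_value (Suc j) X \<le> singular_value (Suc i) X"
proof -
  have "x \<bullet> ((X ** transpose X) *v y) = ((X ** transpose X) *v x) \<bullet> y" for x y
    by (metis gram_inner inner_commute)
  then obtain u \<mu> where e: "eigensystem ((*v) (X ** transpose X)) u \<mu>"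
    and dec: "\<And>i j. i \<le> j \<Longrightarrow> j < DIM(real^'m) \<Longrightarrow> \<mu> j \<le> \<mu> i"
    using spectral[of "(*v) (X ** transpose X)"] linear_matrix_vector by metis
  have s: "singular_value (Suc j) X = sqrt (\<mu> j)" if "j < CARD('m)" for j
    using singular_value_eigensystem[OF e] dec that by simp
  have nn: "0 \<le> \<mu> j" if "j < CARD('m)" for j
    using gram_eigenvalue_nonneg[OF e that] .
  show ?thesis
  proof (rule that)
    show "left_singular_basis X u"
      using e s nn by (simp add: left_singular_basis_def eigensystem_def)
  qed (use s nn dec in auto)
qed

lemma singular_value_nonneg: "j < CARD('m) \<Longrightarrow> 0 \<le> singular_value (Suc j) (X :: real^'n^'m)"
  using singular_values by metis

lemma singular_value_antimono:
  "i \<le> j \<Longrightarrow> j < CARD('m) \<Longrightarrow> singular_value (Suc j) (X :: real^'n^'m) \<le> singular_value (Suc i) X"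
  using singular_values by metis

lemma left_singular_basis_orthonormal:
  fixes X :: "real^'n^'m"
  shows "left_singular_basis X u \<Longrightarrow> orthonormal_upto CARD('m) u"
  by (simp add: left_singular_basis_def eigensystem_def)

lemma left_singular_basis_inner:
  fixes X :: "real^'n^'m"
  assumes "left_singular_basis X u" "i < CARD('m)" "j < CARD('m)"
  shows "(transpose X *v u i) \<bullet> (transpose X *v u j) =
    (if i = j then (singular_value (Suc j) X)\<^sup>2 else 0)"
  using assms unfolding gram_inner[symmetric]
  by (auto simp: left_singular_basis_def eigensystem_def orthonormal_upto_def)

lemma left_singular_basis_norm:
  fixes X :: "real^'n^'m"
  assumes "left_singular_basis X u" "j < CARD('m)"
  shows "norm (transpose X *v u j) = singular_value (Suc j) X"
  using left_singular_basis_inner[OF assms(1,2,2)] singular_value_nonneg[OF assms(2), of X]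
  by (simp add: norm_eq_sqrt_inner)

section \<open>Outer products and interlacing\<close>

definition outer :: "real^'m \<Rightarrow> real^'n \<Rightarrow> real^'n^'m" where
  "outer u w = (\<chi> i j. u $ i * w $ j)"

lemma outer_mult: "outer u w *v y = (w \<bullet> y) *\<^sub>R u"
  by (simp add: vec_eq_iff outer_def matrix_vector_mult_def inner_vec_def sum_distrib_left mult_ac)

lemma transpose_outer: "transpose (outer u w) = outer w u"
  by (simp add: vec_eq_iff outer_def transpose_def)

lemma transpose_add: "transpose (A + B) = transpose A + transpose (B :: 'a::plus^'n^'m)"
  by (simp add: vec_eq_iff transpose_def)

text \<open>A vector orthogonal to \<open>u\<close> does not see the perturbation: both transposes
  map it to the same vector, so the two Gram forms agree there and the min-max bounds can be
  chained.\<close>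

lemma singular_value_interlace:
  fixes A B :: "real^'n^'m"
  assumes B: "B = A + outer u w" and i: "Suc i < CARD('m)"
  shows "singular_value (Suc (Suc i)) B \<le> singular_value (Suc i) A"
proof -
  obtain a where a: "left_singular_basis A a" using singular_values by metis
  obtain b where b: "left_singular_basis B b" using singular_values by metis
  \<comment> \<open>The sought vector must avoid \<open>u\<close>, the first \<open>i\<close>
    vectors of \<open>a\<close> and the last \<open>m - i - 2\<close> of \<open>b\<close>, which is
    at most \<open>m - 1\<close> constraints.\<close>
  define F where "F = insert u (a ` {..<i} \<union> b ` {Suc i<..<CARD('m)})"
  have "card F \<le> Suc (card (a ` {..<i} \<union> b ` {Suc i<..<CARD('m)}))"
    unfolding F_def by (rule card_insert_le_m1) auto
  also have "\<dots> \<le> Suc (card (a ` {..<i}) + card (b ` {Suc i<..<CARD('m)}))"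
    using card_Un_le by auto
  also have "\<dots> \<le> Suc (i + (CARD('m) - Suc (Suc i)))"
    using card_image_le[of "{..<i}" a] card_image_le[of "{Suc i<..<CARD('m)}" b] by simp
  also have "\<dots> < DIM(real^'m)" using i by simp
  finally obtain x where x: "x \<noteq> 0" "\<And>f. f \<in> F \<Longrightarrow> x \<bullet> f = 0"
    using exists_nonzero_orthogonal[of F] by (auto simp: F_def)
  have sq: "(singular_value (Suc j) X)\<^sup>2 \<le> (singular_value (Suc i) X)\<^sup>2"
    if "i \<le> j" "j < CARD('m)" for i j and X :: "real^'n^'m"
    using that by (intro power_mono singular_value_antimono singular_value_nonneg) auto
  have "(singular_value (Suc (Suc i)) B)\<^sup>2 * (x \<bullet> x) \<le> x \<bullet> ((B ** transpose B) *v x)"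
    using b x sq i unfolding left_singular_basis_def
    by (intro eigensystem_form_ge[of _ b "\<lambda>j. (singular_value (Suc j) B)\<^sup>2"]) (auto simp: F_def)
  also have "\<dots> = x \<bullet> ((A ** transpose A) *v x)"
  proof -
    have "transpose B *v x = transpose A *v x"
      using x(2)[of u] by (simp add: B transpose_add matrix_vector_mult_add_rdistrib transpose_outer
          outer_mult F_def inner_commute)
    then show ?thesis by (simp add: gram_inner)
  qed
  also have "\<dots> \<le> (singular_value (Suc i) A)\<^sup>2 * (x \<bullet> x)"
    using a x sq i unfolding left_singular_basis_def
    by (intro eigensystem_form_le[of _ a "\<lambda>j. (singular_value (Suc j) A)\<^sup>2"]) (auto simp: F_def)
  finally have "(singular_value (Suc (Suc i)) B)\<^sup>2 \<le> (singular_value (Suc i) A)\<^sup>2"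
    by (rule mult_right_le_imp_le) (simp add: x(1))
  then show ?thesis
    by (rule power2_le_imp_le) (use i in \<open>simp add: singular_value_nonneg\<close>)
qed

subsection \<open>Rank-one perturbations\<close>

text \<open>The derivative is nonpositive because \<open>p - 1 < 0\<close>. It is taken in the open
  interval, with continuity at the ends, as \<open>x\<close> may be 0, where the power is not
  differentiable.\<close>

lemma powr_increment_antimono:
  fixes x y d p :: real
  assumes "0 < p" "p < 1" "0 \<le> x" "x \<le> y" "0 \<le> d"
  shows "(y + d) powr p - y powr p \<le> (x + d) powr p - x powr p"
proof (rule DERIV_nonpos_imp_decreasing_open[of x y "\<lambda>t. (t + d) powr p - t powr p"])
  fix t assume t: "x < t" "t < y"
  have "((\<lambda>t. (t + d) powr p - t powr p) has_real_derivative
      p * (t + d) powr (p - 1) - p * t powr (p - 1)) (at t)"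
    using t assms by (auto intro!: derivative_eq_intros simp: powr_diff)
  moreover have "(t + d) powr (p - 1) \<le> t powr (p - 1)"
    using t assms by (intro powr_mono2') auto
  ultimately show "\<exists>D. ((\<lambda>t. (t + d) powr p - t powr p) has_real_derivative D) (at t) \<and> D \<le> 0"
    using assms by (intro exI[of _ "p * (t + d) powr (p - 1) - p * t powr (p - 1)"]) auto
next
  show "continuous_on {x..y} (\<lambda>t. (t + d) powr p - t powr p)"
    using assms by (intro continuous_on_diff continuous_on_powr' continuous_intros) auto
qed fact

text \<open>The intervals between \<open>a j\<close> and \<open>b j\<close> are disjoint, so by concavity the increments are largest
  when the intervals are pushed together towards \<open>0\<close>.\<close>

lemma sum_powr_interlaced:
  fixes a b :: "nat \<Rightarrow> real"
  assumes p: "0 < p" "p < 1"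
    and "\<And>j. j < n \<Longrightarrow> 0 \<le> a j" "\<And>j. j < n \<Longrightarrow> 0 \<le> b j"
    and "\<And>j. Suc j < n \<Longrightarrow> a (Suc j) \<le> a j" "\<And>j. Suc j < n \<Longrightarrow> b (Suc j) \<le> b j"
    and "\<And>j. Suc j < n \<Longrightarrow> a (Suc j) \<le> b j" "\<And>j. Suc j < n \<Longrightarrow> b (Suc j) \<le> a j"
  shows "(\<Sum>j<n. \<bar>a j powr p - b j powr p\<bar>) \<le> (\<Sum>j<n. \<bar>a j - b j\<bar>) powr p"
proof -
  \<comment> \<open>The second conjunct strengthens the induction: the total length of the later
    intervals has to fit below both \<open>a 0\<close> and \<open>b 0\<close>.\<close>
  have "(\<Sum>j<n. \<bar>a j powr p - b j powr p\<bar>) \<le> (\<Sum>j<n. \<bar>a j - b j\<bar>) powr p \<and>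
    (0 < n \<longrightarrow> (\<Sum>j<n. \<bar>a j - b j\<bar>) \<le> max (a 0) (b 0))"
    using assms(3-)
  proof (induction n arbitrary: a b)
    case (Suc n)
    define S where "S = (\<Sum>j<n. \<bar>a (Suc j) - b (Suc j)\<bar>)"
    have IH: "(\<Sum>j<n. \<bar>a (Suc j) powr p - b (Suc j) powr p\<bar>) \<le> S powr p"
      "0 < n \<Longrightarrow> S \<le> max (a 1) (b 1)"
      using Suc.IH[of "\<lambda>j. a (Suc j)" "\<lambda>j. b (Suc j)"] Suc.prems by (auto simp: S_def)
    have nn: "0 \<le> a 0" "0 \<le> b 0" using Suc.prems by auto
    have S: "0 \<le> S" "S \<le> min (a 0) (b 0)"
    proof -
      show "0 \<le> S" by (simp add: S_def sum_nonneg)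
      show "S \<le> min (a 0) (b 0)"
      proof (cases "n = 0")
        case False
        then have "max (a 1) (b 1) \<le> min (a 0) (b 0)"
          using Suc.prems(3-6)[of 0] by simp
        moreover have "S \<le> max (a 1) (b 1)" using IH(2) False by simp
        ultimately show ?thesis by linarith
      qed (use nn in \<open>simp add: S_def\<close>)
    qed
    define d where "d = \<bar>a 0 - b 0\<bar>"
    have "\<bar>a 0 powr p - b 0 powr p\<bar> = (min (a 0) (b 0) + d) powr p - min (a 0) (b 0) powr p"
      using nn p powr_mono2[of p "a 0" "b 0"] powr_mono2[of p "b 0" "a 0"]
      by (cases "a 0 \<le> b 0") (auto simp: d_def)
    \<comment> \<open>The top interval is moved down to start at \<open>S\<close>, where the others
      end once they are packed from 0 upwards.\<close>
    also have "\<dots> \<le> (S + d) powr p - S powr p"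
      using S p by (intro powr_increment_antimono) (auto simp: d_def)
    finally have "\<bar>a 0 powr p - b 0 powr p\<bar> \<le> (S + d) powr p - S powr p" .
    moreover have "S + d \<le> max (a 0) (b 0)" using S by (auto simp: d_def)
    ultimately show ?case
      using IH(1) unfolding sum.lessThan_Suc_shift by (simp add: S_def[symmetric] d_def add.commute)
  qed simp
  then show ?thesis by blast
qed

section \<open>Dilations and their eigenvalues\<close>

text \<open>As the vectors may be short, \<open>z\<close> need not be a projection of
  \<open>y\<close>, but \<open>z \<bullet> z \<le> y \<bullet> z\<close> survives and combines with
  the nonnegative square of \<open>y - z\<close>.\<close>

lemma bessel_subnormal:
  fixes v :: "nat \<Rightarrow> 'a::real_inner"
  assumes orth: "\<And>i j. i < n \<Longrightarrow> j < n \<Longrightarrow> i \<noteq> j \<Longrightarrow> v i \<bullet> v j = 0"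
    and le1: "\<And>j. j < n \<Longrightarrow> v j \<bullet> v j \<le> 1"
  shows "(\<Sum>j<n. (y \<bullet> v j)\<^sup>2) \<le> y \<bullet> y"
proof -
  define z where "z = (\<Sum>j<n. (y \<bullet> v j) *\<^sub>R v j)"
  have yz: "y \<bullet> z = (\<Sum>j<n. (y \<bullet> v j)\<^sup>2)"
    by (simp add: z_def inner_sum_right power2_eq_square)
  have "z \<bullet> v j = (y \<bullet> v j) * (v j \<bullet> v j)" if "j < n" for j
  proof -
    have "z \<bullet> v j = (\<Sum>i<n. if i = j then (y \<bullet> v j) * (v j \<bullet> v j) else 0)"
      unfolding z_def inner_sum_left by (rule sum.cong) (auto simp: orth that)
    then show ?thesis using that by simp
  qed
  then have "z \<bullet> z = (\<Sum>j<n. (y \<bullet> v j)\<^sup>2 * (v j \<bullet> v j))"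
    by (subst (2) z_def) (simp add: inner_sum_right power2_eq_square mult_ac)
  also have "\<dots> \<le> (\<Sum>j<n. (y \<bullet> v j)\<^sup>2)"
    using le1 by (intro sum_mono mult_left_le) auto
  finally have "z \<bullet> z \<le> y \<bullet> z" using yz by simp
  moreover have "0 \<le> (y - z) \<bullet> (y - z)" by simp
  ultimately show ?thesis
    unfolding yz[symmetric] by (simp add: inner_diff_left inner_diff_right inner_commute)
qed

text \<open>The right singular vectors are \<open>0\<close> where the singular value vanishes (through division
  by zero), which is why they are only subnormal.\<close>

lemma right_singular_vectors:
  fixes A :: "real^'n^'m"
  assumes u: "left_singular_basis A u"
  obtains v where "\<And>j. j < CARD('m) \<Longrightarrow> transpose A *v u j = singular_value (Suc j) A *\<^sub>R v j"
    and "\<And>i j. i < CARD('m) \<Longrightarrow> j < CARD('m) \<Longrightarrow> i \<noteq> j \<Longrightarrow> v i \<bullet> v j = 0"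
    and "\<And>j. j < CARD('m) \<Longrightarrow> v j \<bullet> v j \<le> 1"
    and "\<And>x y. x \<bullet> (A *v y) = (\<Sum>j<CARD('m). singular_value (Suc j) A * (x \<bullet> u j) * (y \<bullet> v j))"
proof -
  define s where "s j = singular_value (Suc j) A" for j
  define v where "v j = (1 / s j) *\<^sub>R (transpose A *v u j)" for j
  have Au: "transpose A *v u j = s j *\<^sub>R v j" if "j < CARD('m)" for j
  proof (cases "s j = 0")
    case True
    then have "transpose A *v u j = 0"
      using left_singular_basis_norm[OF u that] by (simp add: s_def)
    then show ?thesis using True by simp
  qed (simp add: v_def)
  have form: "x \<bullet> (A *v y) = (\<Sum>j<CARD('m). s j * (x \<bullet> u j) * (y \<bullet> v j))" for x y
  proof -
    have "x = (\<Sum>j<CARD('m). (x \<bullet> u j) *\<^sub>R u j)"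
      using orthonormal_expansion[of u x] left_singular_basis_orthonormal[OF u] by simp
    then have "x \<bullet> (A *v y) = (\<Sum>j<CARD('m). (x \<bullet> u j) *\<^sub>R u j) \<bullet> (A *v y)" by simp
    also have "\<dots> = (\<Sum>j<CARD('m). (x \<bullet> u j) * (u j \<bullet> (A *v y)))"
      by (simp add: inner_sum_left)
    also have "\<dots> = (\<Sum>j<CARD('m). s j * (x \<bullet> u j) * (y \<bullet> v j))"
    proof (rule sum.cong)
      fix j assume j: "j \<in> {..<CARD('m)}"
      have "u j \<bullet> (A *v y) = (transpose A *v u j) \<bullet> y"
        by (metis dot_lmul_matrix transpose_matrix_vector)
      also have "transpose A *v u j = s j *\<^sub>R v j" using Au j by simp
      finally show "(x \<bullet> u j) * (u j \<bullet> (A *v y)) = s j * (x \<bullet> u j) * (y \<bullet> v j)"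
        by (simp add: inner_commute)
    qed simp
    finally show ?thesis .
  qed
  show ?thesis
  proof (rule that[of v])
    show "v i \<bullet> v j = 0" if "i < CARD('m)" "j < CARD('m)" "i \<noteq> j" for i j
      using left_singular_basis_inner[OF u that(1,2)] that by (simp add: v_def)
    show "v j \<bullet> v j \<le> 1" if "j < CARD('m)" for j
      using left_singular_basis_inner[OF u that that] by (simp add: v_def s_def power2_eq_square)
  qed (use Au form in \<open>auto simp: s_def\<close>)
qed

text \<open>If a symmetric operator dominates the dilation of \<open>A\<close>, its eigenvalues dominate
  \<open>\<sigma>\<^sub>1, \<dots>, \<sigma>\<^sub>m, 0, \<dots>, 0, -\<sigma>\<^sub>m, \<dots>, -\<sigma>\<^sub>1\<close>.\<close>

lemma dilation_eigenvalues:
  fixes A :: "real^'n^'m" and T :: "(real^'m) \<times> (real^'n) \<Rightarrow> (real^'m) \<times> (real^'n)"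
  assumes T: "eigensystem T f \<mu>" "linear T"
    and dec: "\<And>i j. i \<le> j \<Longrightarrow> j < DIM((real^'m) \<times> (real^'n)) \<Longrightarrow> \<mu> j \<le> \<mu> i"
    and dom: "\<And>x y. 2 * (x \<bullet> (A *v y)) \<le> (x, y) \<bullet> T (x, y)"
  shows "i < CARD('m) \<Longrightarrow> singular_value (Suc i) A \<le> \<mu> i"
    and "i < CARD('n) \<Longrightarrow> 0 \<le> \<mu> i"
    and "i < CARD('m) \<Longrightarrow> - singular_value (Suc i) A \<le> \<mu> (CARD('m) + CARD('n) - 1 - i)"
proof -
  let ?m = "CARD('m)" and ?n = "CARD('n)"
  define s where "s j = singular_value (Suc j) A" for j
  have s0: "0 \<le> s j" if "j < ?m" for j using singular_value_nonneg that by (simp add: s_def)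
  obtain u where u: "left_singular_basis A u" using singular_values by metis
  obtain v where Au: "\<And>j. j < ?m \<Longrightarrow> transpose A *v u j = s j *\<^sub>R v j"
    and vv: "\<And>i j. i < ?m \<Longrightarrow> j < ?m \<Longrightarrow> i \<noteq> j \<Longrightarrow> v i \<bullet> v j = 0"
    and v1: "\<And>j. j < ?m \<Longrightarrow> v j \<bullet> v j \<le> 1"
    and form: "\<And>x y. x \<bullet> (A *v y) = (\<Sum>j<?m. s j * (x \<bullet> u j) * (y \<bullet> v j))"
    by (rule right_singular_vectors[OF u, folded s_def]) (rule that, assumption+)
  have on: "orthonormal_upto ?m u" using left_singular_basis_orthonormal[OF u] .
  have parseval: "x \<bullet> x = (\<Sum>j<?m. (x \<bullet> u j)\<^sup>2)" for x
    using orthonormal_inner[of u x x] on by (simp add: power2_eq_square)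
  have zpos: "0 < z \<bullet> z" if "z \<noteq> 0" for z :: "(real^'m) \<times> (real^'n)" using that by simp
  have upper: "z \<bullet> T z \<le> \<mu> i * (z \<bullet> z)" if "\<And>j. j < i \<Longrightarrow> z \<bullet> f j = 0" for i z
    using eigensystem_form_le[OF T dec] that by blast
  show "singular_value (Suc i) A \<le> \<mu> i" if i: "i < ?m"
  proof -
    \<comment> \<open>The vectors \<open>u j\<close> with \<open>i < j\<close> confine
      \<open>x\<close> to the leading left singular vectors. The second set expresses, in terms of
      \<open>x\<close> alone, that \<open>(x, y)\<close> is orthogonal to \<open>f l\<close>, where
      \<open>y\<close> arises from \<open>x\<close> by replacing each \<open>u j\<close> with
      \<open>v j\<close>.\<close>
    define F where "F = u ` {i<..<?m} \<union>
      (\<lambda>l. fst (f l) + (\<Sum>j<?m. (v j \<bullet> snd (f l)) *\<^sub>R u j)) ` {..<i}"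
    have "card F \<le> (?m - Suc i) + i"
      unfolding F_def by (intro order_trans[OF card_Un_le] add_mono order_trans[OF card_image_le]) auto
    then have "card F < DIM(real^'m)" using i by (simp)
    moreover have "finite F" by (simp add: F_def)
    ultimately obtain x where x: "x \<noteq> 0" "\<And>g. g \<in> F \<Longrightarrow> x \<bullet> g = 0"
      using exists_nonzero_orthogonal[of F] by blast
    define y where "y = (\<Sum>j<?m. (x \<bullet> u j) *\<^sub>R v j)"
    have yv: "y \<bullet> v j = (x \<bullet> u j) * (v j \<bullet> v j)" if "j < ?m" for j
    proof -
      have "y \<bullet> v j = (\<Sum>i<?m. if i = j then (x \<bullet> u j) * (v j \<bullet> v j) else 0)"
        unfolding y_def inner_sum_left by (rule sum.cong) (auto simp: vv that)
      then show ?thesis using that by simp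
    qed
    have yy: "y \<bullet> y = (\<Sum>j<?m. (x \<bullet> u j)\<^sup>2 * (v j \<bullet> v j))"
      by (subst (2) y_def) (simp add: inner_sum_right yv power2_eq_square mult_ac)
    have "y \<bullet> z = (\<Sum>j<?m. (x \<bullet> u j) * (v j \<bullet> z))" for z
      by (simp add: y_def inner_sum_left)
    then have "(x, y) \<bullet> f l = x \<bullet> (fst (f l) + (\<Sum>j<?m. (v j \<bullet> snd (f l)) *\<^sub>R u j))" for l
      by (simp add: inner_prod_def inner_add_right inner_sum_right mult_ac)
    then have "(x, y) \<bullet> f l = 0" if "l < i" for l using x(2) that by (auto simp: F_def)
    then have up: "(x, y) \<bullet> T (x, y) \<le> \<mu> i * ((x, y) \<bullet> (x, y))" by (rule upper)
    have "s i * ((x, y) \<bullet> (x, y)) = (\<Sum>j<?m. s i * ((x \<bullet> u j)\<^sup>2 * (1 + v j \<bullet> v j)))"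
      by (simp add: yy parseval sum.distrib distrib_left sum_distrib_left)
    also have "\<dots> \<le> (\<Sum>j<?m. 2 * (s j * (x \<bullet> u j) * (y \<bullet> v j)))"
    proof (rule sum_mono)
      fix j assume j: "j \<in> {..<?m}"
      show "s i * ((x \<bullet> u j)\<^sup>2 * (1 + v j \<bullet> v j)) \<le> 2 * (s j * (x \<bullet> u j) * (y \<bullet> v j))"
      \<comment> \<open>Either the left side vanishes, or \<open>s j\<close> is positive and
        \<open>v j\<close> is therefore a unit vector.\<close>
      proof (cases "s i = 0 \<or> i < j")
        case True
        then have "s i * ((x \<bullet> u j)\<^sup>2 * (1 + v j \<bullet> v j)) = 0"
          using x(2)[of "u j"] j by (auto simp: F_def)
        moreover have "0 \<le> s j * ((x \<bullet> u j)\<^sup>2 * (v j \<bullet> v j))" using s0[of j] j by simp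
        ultimately have "s i * ((x \<bullet> u j)\<^sup>2 * (1 + v j \<bullet> v j)) \<le> 2 * (s j * ((x \<bullet> u j)\<^sup>2 * (v j \<bullet> v j)))"
          by linarith
        also have "\<dots> = 2 * (s j * (x \<bullet> u j) * (y \<bullet> v j))"
          using j by (simp add: yv power2_eq_square mult_ac)
        finally show ?thesis .
      next
        case False
        then have "s i \<le> s j" unfolding s_def using i by (intro singular_value_antimono) auto
        moreover from this have "s j > 0" using False s0[OF i] by linarith
        moreover have "(s j)\<^sup>2 * (v j \<bullet> v j) = (s j)\<^sup>2"
          using left_singular_basis_inner[OF u, of j j] Au[of j] j
          by (simp add: s_def power2_eq_square mult.assoc)
        ultimately have vj: "v j \<bullet> v j = 1" by simp
        have "s i * (x \<bullet> u j)\<^sup>2 \<le> s j * (x \<bullet> u j)\<^sup>2"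
          using \<open>s i \<le> s j\<close> by (rule mult_right_mono) simp
        then show ?thesis using j by (simp add: yv vj power2_eq_square mult_ac)
      qed
    qed
    also have "\<dots> \<le> (x, y) \<bullet> T (x, y)" using dom[of x y] by (simp add: form sum_distrib_left)
    finally have "s i * ((x, y) \<bullet> (x, y)) \<le> \<mu> i * ((x, y) \<bullet> (x, y))" using up by simp
    then show ?thesis using zpos[of "(x, y)"] x(1) by (simp add: s_def zero_prod_def)
  qed
  show "0 \<le> \<mu> i" if i: "i < ?n"
  proof -
    \<comment> \<open>The pair \<open>(u j, - v j)\<close> is an eigenvector of the dilation for
      \<open>- s j\<close>. Orthogonality to all these pairs makes the dilation form
      nonnegative.\<close>
    define F where "F = (\<lambda>j. (u j, - v j)) ` {..<?m} \<union> f ` {..<i}"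
    have "card F \<le> ?m + i"
      unfolding F_def by (intro order_trans[OF card_Un_le] add_mono order_trans[OF card_image_le]) auto
    then have "card F < DIM((real^'m) \<times> (real^'n))" using i by (simp)
    moreover have "finite F" by (simp add: F_def)
    ultimately obtain z where z: "z \<noteq> 0" "\<And>g. g \<in> F \<Longrightarrow> z \<bullet> g = 0"
      using exists_nonzero_orthogonal[of F] by blast
    obtain x y where zxy: "z = (x, y)" by fastforce
    have eq: "x \<bullet> u j = y \<bullet> v j" if "j < ?m" for j
      using z(2)[of "(u j, - v j)"] that by (auto simp: F_def zxy)
    have "0 \<le> (\<Sum>j<?m. s j * (x \<bullet> u j) * (y \<bullet> v j))"
      using s0 eq by (intro sum_nonneg) (auto simp: mult.assoc)
    then have "0 \<le> z \<bullet> T z" using dom[of x y] by (simp add: form zxy)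
    also have "\<dots> \<le> \<mu> i * (z \<bullet> z)" using z(2) by (intro upper) (auto simp: F_def)
    finally show ?thesis using zpos[OF z(1)] by (simp add: zero_le_mult_iff)
  qed
  show "- singular_value (Suc i) A \<le> \<mu> (?m + ?n - 1 - i)" if i: "i < ?m"
  proof -
    define k where "k = ?m + ?n - 1 - i"
    \<comment> \<open>Only the first \<open>i\<close> of the negative directions are excluded, so
      the form stays above \<open>- s i\<close> times the squared length. The \<open>i + k\<close>
      constraints are one fewer than the dimension.\<close>
    define F where "F = (\<lambda>j. (u j, - v j)) ` {..<i} \<union> f ` {..<k}"
    have "card F \<le> i + k"
      unfolding F_def by (intro order_trans[OF card_Un_le] add_mono order_trans[OF card_image_le]) auto
    then have "card F < DIM((real^'m) \<times> (real^'n))" using i by (simp add: k_def)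
    moreover have "finite F" by (simp add: F_def)
    ultimately obtain z where z: "z \<noteq> 0" "\<And>g. g \<in> F \<Longrightarrow> z \<bullet> g = 0"
      using exists_nonzero_orthogonal[of F] by blast
    obtain x y where zxy: "z = (x, y)" by fastforce
    have eq: "x \<bullet> u j = y \<bullet> v j" if "j < i" for j
      using z(2)[of "(u j, - v j)"] that by (auto simp: F_def zxy)
    have "- s i * ((x \<bullet> u j)\<^sup>2 + (y \<bullet> v j)\<^sup>2) \<le> 2 * (s j * (x \<bullet> u j) * (y \<bullet> v j))" if j: "j < ?m" for j
    proof (cases "j < i")
      case True
      have "0 \<le> s i * ((x \<bullet> u j)\<^sup>2 + (y \<bullet> v j)\<^sup>2)" using s0[OF i] by simp
      moreover have "0 \<le> s j * (x \<bullet> u j) * (y \<bullet> v j)"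
        using s0[OF j] eq[OF True] by (auto simp: mult.assoc)
      ultimately show ?thesis by simp
    next
      case False
      then have "s j \<le> s i" using j unfolding s_def by (intro singular_value_antimono) auto
      then have "s j * ((x \<bullet> u j)\<^sup>2 + (y \<bullet> v j)\<^sup>2) \<le> s i * ((x \<bullet> u j)\<^sup>2 + (y \<bullet> v j)\<^sup>2)"
        by (intro mult_right_mono) auto
      moreover have "0 \<le> s j * (x \<bullet> u j + y \<bullet> v j)\<^sup>2" using s0[OF j] by simp
      ultimately show ?thesis by (simp add: power2_eq_square algebra_simps)
    qed
    then have "(\<Sum>j<?m. - s i * ((x \<bullet> u j)\<^sup>2 + (y \<bullet> v j)\<^sup>2)) \<le> (\<Sum>j<?m. 2 * (s j * (x \<bullet> u j) * (y \<bullet> v j)))"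
      by (intro sum_mono) auto
    also have "\<dots> \<le> z \<bullet> T z" using dom[of x y] by (simp add: form zxy sum_distrib_left)
    also have "\<dots> \<le> \<mu> k * (z \<bullet> z)" using z(2) by (intro upper) (auto simp: F_def)
    finally have 1: "- s i * ((\<Sum>j<?m. (x \<bullet> u j)\<^sup>2) + (\<Sum>j<?m. (y \<bullet> v j)\<^sup>2)) \<le> \<mu> k * (z \<bullet> z)"
      by (simp only: sum.distrib flip: sum_distrib_left)
    have "(\<Sum>j<?m. (x \<bullet> u j)\<^sup>2) + (\<Sum>j<?m. (y \<bullet> v j)\<^sup>2) \<le> z \<bullet> z"
      using bessel_subnormal[of ?m v y] vv v1 by (simp add: zxy parseval)
    \<comment> \<open>Multiplying by the nonpositive \<open>- s i\<close> reverses the Bessel bound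
      into the direction required.\<close>
    then have "- s i * (z \<bullet> z) \<le> - s i * ((\<Sum>j<?m. (x \<bullet> u j)\<^sup>2) + (\<Sum>j<?m. (y \<bullet> v j)\<^sup>2))"
      using s0[OF i] by (intro mult_left_mono_neg) auto
    with 1 have "- s i * (z \<bullet> z) \<le> \<mu> k * (z \<bullet> z)" by linarith
    then show ?thesis using zpos[OF z(1)] unfolding k_def[symmetric] s_def
      using mult_le_cancel_right_pos by blast
  qed
qed

lemma sum_Basis_prod:
  "sum g (Basis :: ('a::euclidean_space \<times> 'b::euclidean_space) set) =
    (\<Sum>b\<in>Basis. g (b, 0)) + (\<Sum>b\<in>Basis. g (0, b))"
proof -
  have "inj_on (\<lambda>b. (b :: 'a, 0 :: 'b)) Basis" "inj_on (\<lambda>b. (0 :: 'a, b :: 'b)) Basis"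
    by (auto intro!: inj_onI)
  then show ?thesis
    unfolding Basis_prod_def by (subst sum.union_disjoint) (auto simp: sum.reindex)
qed

text \<open>If \<open>T\<close> dominates both dilations, its eigenvalues are at least the larger
  singular values at the top, 0 in the middle and minus the smaller ones at the bottom. Adding up,
  the absolute differences sum to at most the trace of \<open>T\<close>.\<close>

lemma sum_abs_singular_value_diff_rank_one:
  fixes A B :: "real^'n^'m"
  assumes mn: "CARD('m) \<le> CARD('n)" and B: "B = A + outer u w" and u: "norm u = 1"
  shows "(\<Sum>j<CARD('m). \<bar>singular_value (Suc j) A - singular_value (Suc j) B\<bar>) \<le> norm w"
proof (cases "w = 0")
  case True
  then have "B = A" by (simp add: B vec_eq_iff outer_def)
  then show ?thesis by simp
next
  case False
  let ?m = "CARD('m)" and ?n = "CARD('n)"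
  define s where "s = norm w"
  define v where "v = (1 / s) *\<^sub>R w"
  have s: "0 < s" and w: "w = s *\<^sub>R v" and vv: "v \<bullet> v = 1" and uu: "u \<bullet> u = 1"
    using False u by (auto simp: s_def v_def dot_square_norm power2_eq_square)
  \<comment> \<open>This is the dilation of \<open>A\<close> plus \<open>s / 2\<close> times the
    outer square of \<open>(u, v)\<close>. Its form exceeds that of the dilation of \<open>A\<close>
    by \<open>s / 2\<close> times the square of \<open>x \<bullet> u + y \<bullet> v\<close>, and
    that of \<open>B\<close> by the same with a minus sign inside the square. Dilations have trace
    0, so the trace is \<open>s\<close>.\<close>
  define T :: "(real^'m) \<times> (real^'n) \<Rightarrow> (real^'m) \<times> (real^'n)" where
    "T z = (A *v snd z + (s / 2 * (fst z \<bullet> u + snd z \<bullet> v)) *\<^sub>R u,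
      transpose A *v fst z + (s / 2 * (fst z \<bullet> u + snd z \<bullet> v)) *\<^sub>R v)" for z
  have adj: "(transpose A *v x) \<bullet> y = x \<bullet> (A *v y)" for x y
    by (metis dot_lmul_matrix transpose_matrix_vector)
  have "linear T"
    by (rule linearI) (auto simp: T_def matrix_vector_right_distrib matrix_vector_mult_scaleR
        inner_add_left algebra_simps)
  moreover have "x \<bullet> T y = T x \<bullet> y" for x y
    using adj[of "fst x" "snd y"] adj[of "fst y" "snd x"]
    by (simp add: T_def inner_prod_def inner_add_left inner_add_right inner_commute algebra_simps)
  ultimately obtain f \<mu> where e: "eigensystem T f \<mu>"
    and dec: "\<And>i j. i \<le> j \<Longrightarrow> j < DIM((real^'m) \<times> (real^'n)) \<Longrightarrow> \<mu> j \<le> \<mu> i"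
    using spectral[of T] by metis
  have q: "(x, y) \<bullet> T (x, y) = 2 * (x \<bullet> (A *v y)) + s / 2 * (x \<bullet> u + y \<bullet> v)\<^sup>2" for x y
    using adj[of x y]
    by (simp add: T_def inner_add_right inner_commute power2_eq_square algebra_simps)
  have domA: "2 * (x \<bullet> (A *v y)) \<le> (x, y) \<bullet> T (x, y)" for x y
    using s by (simp add: q)
  have domB: "2 * (x \<bullet> (B *v y)) \<le> (x, y) \<bullet> T (x, y)" for x y
  proof -
    have "x \<bullet> (B *v y) = x \<bullet> (A *v y) + s * (x \<bullet> u) * (y \<bullet> v)"
      by (simp add: B matrix_vector_mult_add_rdistrib outer_mult w inner_add_right inner_commute)
    moreover have "0 \<le> s / 2 * (x \<bullet> u - y \<bullet> v)\<^sup>2" using s by simp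
    ultimately show ?thesis by (simp add: q power2_eq_square algebra_simps)
  qed
  note A = dilation_eigenvalues[OF e \<open>linear T\<close> dec domA]
  note B = dilation_eigenvalues[OF e \<open>linear T\<close> dec domB]
  have "(\<Sum>j<?m + ?n. \<mu> j) = (\<Sum>b\<in>Basis. b \<bullet> T b)"
    using eigensystem_trace[OF e \<open>linear T\<close>] by simp
  also have "\<dots> = s / 2 * ((\<Sum>b\<in>Basis. (u \<bullet> b) * (u \<bullet> b)) + (\<Sum>b\<in>Basis. (v \<bullet> b) * (v \<bullet> b)))"
    by (simp add: sum_Basis_prod q power2_eq_square inner_commute sum_distrib_left distrib_left)
  also have "\<dots> = s" by (simp add: uu vv flip: euclidean_inner)
  finally have trace: "(\<Sum>j<?m + ?n. \<mu> j) = s" .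
  \<comment> \<open>By \<open>mn\<close> there is a middle block of \<open>n - m\<close>
    eigenvalues; the last \<open>m\<close> are then counted from the bottom.\<close>
  have "(\<Sum>j<?m + ?n. \<mu> j) = (\<Sum>j<?m. \<mu> j) + (\<Sum>j=?m..<?n. \<mu> j) + (\<Sum>j=?n..<?m + ?n. \<mu> j)"
    using mn by (simp add: lessThan_atLeast0 sum.atLeastLessThan_concat)
  also have "(\<Sum>j=?n..<?m + ?n. \<mu> j) = (\<Sum>j<?m. \<mu> (?m + ?n - 1 - j))"
    by (rule sum.reindex_bij_witness[of _ "\<lambda>j. ?m + ?n - 1 - j" "\<lambda>j. ?m + ?n - 1 - j"]) auto
  finally have "(\<Sum>j<?m. \<mu> j) + (\<Sum>j=?m..<?n. \<mu> j) + (\<Sum>j<?m. \<mu> (?m + ?n - 1 - j)) = s"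
    using trace by simp
  moreover have "(\<Sum>j<?m. max (singular_value (Suc j) A) (singular_value (Suc j) B)) \<le> (\<Sum>j<?m. \<mu> j)"
    using A(1) B(1) by (intro sum_mono max.boundedI) simp_all
  moreover have "0 \<le> (\<Sum>j=?m..<?n. \<mu> j)"
    using A(2) by (intro sum_nonneg) simp
  moreover have "(\<Sum>j<?m. - min (singular_value (Suc j) A) (singular_value (Suc j) B))
      \<le> (\<Sum>j<?m. \<mu> (?m + ?n - 1 - j))"
  proof (rule sum_mono)
    fix j assume "j \<in> {..<?m}"
    then have "- singular_value (Suc j) A \<le> \<mu> (?m + ?n - 1 - j)"
      "- singular_value (Suc j) B \<le> \<mu> (?m + ?n - 1 - j)" using A(3) B(3) by simp_all
    then show "- min (singular_value (Suc j) A) (singular_value (Suc j) B) \<le> \<mu> (?m + ?n - 1 - j)"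
      by linarith
  qed
  ultimately have "(\<Sum>j<?m. max (singular_value (Suc j) A) (singular_value (Suc j) B))
        + (\<Sum>j<?m. - min (singular_value (Suc j) A) (singular_value (Suc j) B)) \<le> s"
    by linarith
  moreover have "\<bar>a - b\<bar> = max a b + - min a b" for a b :: real by auto
  ultimately show ?thesis unfolding s_def[symmetric] by (simp only: sum.distrib)
qed

lemma sum_powr_singular_value_diff_rank_one:
  fixes A B :: "real^'n^'m"
  assumes p: "0 < p" "p < 1" and mn: "CARD('m) \<le> CARD('n)"
    and B: "B = A + outer u w" and u: "norm u = 1"
  shows "(\<Sum>j<CARD('m). \<bar>singular_value (Suc j) A powr p - singular_value (Suc j) B powr p\<bar>)
    \<le> norm w powr p"
proof -
  \<comment> \<open>The roles of \<open>A\<close> and \<open>B\<close> can be exchanged, which gives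
    interlacing in both directions.\<close>
  have A: "A = B + outer u (- w)" by (simp add: B vec_eq_iff outer_def)
  have "(\<Sum>j<CARD('m). \<bar>singular_value (Suc j) A powr p - singular_value (Suc j) B powr p\<bar>)
    \<le> (\<Sum>j<CARD('m). \<bar>singular_value (Suc j) A - singular_value (Suc j) B\<bar>) powr p"
    using singular_value_interlace[OF A] singular_value_interlace[OF B] p
    by (intro sum_powr_interlaced singular_value_nonneg singular_value_antimono) auto
  also have "\<dots> \<le> norm w powr p"
    using sum_abs_singular_value_diff_rank_one[OF mn B u] p by (intro powr_mono2) (auto simp: sum_nonneg)
  finally show ?thesis .
qed

section \<open>Partial singular value decompositions\<close>

lemma sum_matrix_vector_mult:
  "sum f S *v x = (\<Sum>i\<in>S. f i *v x)" for f :: "'i \<Rightarrow> real^'n^'m"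
  by (induction S rule: infinite_finite_induct) (auto simp: matrix_vector_mult_add_rdistrib)

text \<open>As \<open>transpose X *v u j\<close> is the singular value times the right singular
  vector, this is the part of the singular value decomposition indexed by \<open>J\<close>, written
  without division.\<close>

definition svd_part :: "real^'n^'m \<Rightarrow> (nat \<Rightarrow> real^'m) \<Rightarrow> nat set \<Rightarrow> real^'n^'m" where
  "svd_part X u J = (\<Sum>j\<in>J. outer (u j) (transpose X *v u j))"

text \<open>This is the expansion of \<open>X *v y\<close> in the orthonormal basis
  \<open>u\<close>, with the coefficients moved to the transpose.\<close>

lemma svd_part_all:
  fixes X :: "real^'n^'m"
  assumes "left_singular_basis X u"
  shows "svd_part X u {..<CARD('m)} = X"
proof -
  have "svd_part X u {..<CARD('m)} *v y = X *v y" for y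
  proof -
    have "X *v y = (\<Sum>j<CARD('m). ((X *v y) \<bullet> u j) *\<^sub>R u j)"
      using orthonormal_expansion[of u "X *v y"] left_singular_basis_orthonormal[OF assms] by simp
    moreover have "(transpose X *v u j) \<bullet> y = (X *v y) \<bullet> u j" for j
      by (metis dot_lmul_matrix transpose_matrix_vector inner_commute)
    ultimately show ?thesis by (simp only: svd_part_def sum_matrix_vector_mult outer_mult)
  qed
  then show ?thesis by (simp add: matrix_eq)
qed

subsection \<open>The concave Mirsky inequality and recovery\<close>

text \<open>\<open>B - A\<close> is added to \<open>A\<close> one singular component at a time.\<close>

theorem sum_powr_singular_value_diff:
  fixes A B :: "real^'n^'m"
  assumes p: "0 < p" "p < 1" and mn: "CARD('m) \<le> CARD('n)"
  shows "(\<Sum>j<CARD('m). \<bar>singular_value (Suc j) A powr p - singular_value (Suc j) B powr p\<bar>)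
    \<le> schatten_pow p (B - A)"
proof -
  let ?f = "\<lambda>X j. singular_value (Suc j) (X :: real^'n^'m) powr p"
  obtain u where u: "left_singular_basis (B - A) u" using singular_values by metis
  define C where "C k = A + svd_part (B - A) u {..<k}" for k
  have "(\<Sum>j<CARD('m). \<bar>?f A j - ?f (C k) j\<bar>) \<le> (\<Sum>j<k. ?f (B - A) j)" if "k \<le> CARD('m)" for k
    using that
  proof (induction k)
    case 0
    then show ?case by (simp add: C_def svd_part_def)
  next
    case (Suc k)
    \<comment> \<open>The left factor is a unit vector and the length of the right factor is the
      next singular value of \<open>B - A\<close>, so each step costs one term of the Schatten
      sum.\<close>
    have "C (Suc k) = C k + outer (u k) (transpose (B - A) *v u k)"
      by (simp add: C_def svd_part_def)
    moreover have "norm (u k) = 1"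
      using orthonormal_uptoD[OF left_singular_basis_orthonormal[OF u], of k k] Suc.prems
      by (simp add: norm_eq_1)
    ultimately have "(\<Sum>j<CARD('m). \<bar>?f (C k) j - ?f (C (Suc k)) j\<bar>)
        \<le> norm (transpose (B - A) *v u k) powr p"
      by (rule sum_powr_singular_value_diff_rank_one[OF p mn])
    also have "\<dots> = ?f (B - A) k"
      using left_singular_basis_norm[OF u] Suc.prems by simp
    finally have "(\<Sum>j<CARD('m). \<bar>?f A j - ?f (C k) j\<bar>) + (\<Sum>j<CARD('m). \<bar>?f (C k) j - ?f (C (Suc k)) j\<bar>)
        \<le> (\<Sum>j<Suc k. ?f (B - A) j)"
      using Suc by simp
    moreover have "(\<Sum>j<CARD('m). \<bar>?f A j - ?f (C (Suc k)) j\<bar>)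
        \<le> (\<Sum>j<CARD('m). \<bar>?f A j - ?f (C k) j\<bar> + \<bar>?f (C k) j - ?f (C (Suc k)) j\<bar>)"
      by (rule sum_mono) linarith
    ultimately show ?case by (simp add: sum.distrib)
  qed
  from this[of "CARD('m)"] show ?thesis
    by (simp add: C_def svd_part_all[OF u] schatten_pow_lessThan)
qed

section \<open>Rank and truncation\<close>

lemma singular_value_uminus: "singular_value i (- X) = singular_value i X"
proof -
  have "(- X) ** transpose (- X) = X ** transpose X"
    by (simp add: vec_eq_iff matrix_matrix_mult_def transpose_def)
  then show ?thesis by (simp add: singular_value_def gram_eigenvalues_def)
qed

text \<open>Otherwise the first \<open>i + 1\<close> left singular vectors have nonzero, pairwise
  orthogonal images under the transpose, whose rank would then exceed \<open>i\<close>.\<close>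

lemma singular_value_eq_0:
  fixes X :: "real^'n^'m"
  assumes "rank X \<le> i" and i: "i < CARD('m)"
  shows "singular_value (Suc i) X = 0"
proof (rule ccontr)
  assume "singular_value (Suc i) X \<noteq> 0"
  then have pos: "0 < singular_value (Suc j) X" if "j \<le> i" for j
    using singular_value_nonneg[OF i, of X] singular_value_antimono[OF that i, of X] by linarith
  obtain u where u: "left_singular_basis X u" using singular_values by metis
  define w where "w j = transpose X *v u j" for j
  have w: "w j \<bullet> w l = (if j = l then (singular_value (Suc l) X)\<^sup>2 else 0)" if "j \<le> i" "l \<le> i" for j l
    using left_singular_basis_inner[OF u] that i by (simp add: w_def)
  have nz: "w j \<noteq> 0" if "j \<le> i" for j
    using w[OF that that] pos[OF that] by auto
  have "inj_on w {..i}"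
    by (rule inj_onI) (metis atMost_iff inner_eq_zero_iff nz w)
  moreover have "independent (w ` {..i})"
    by (rule pairwise_orthogonal_independent) (use nz w in \<open>auto simp: pairwise_def orthogonal_def\<close>)
  moreover have "w ` {..i} \<subseteq> range ((*v) (transpose X))" by (auto simp: w_def)
  ultimately have "Suc i \<le> dim (range ((*v) (transpose X)))"
    by (metis card_atMost card_image independent_card_le_dim)
  then show False using assms(1) by (simp only: flip: rank_dim_range) (simp add: rank_transpose)
qed

lemma svd_part_mult:
  fixes X :: "real^'n^'m"
  shows "svd_part X u J *v y = (\<Sum>j\<in>J. ((transpose X *v u j) \<bullet> y) *\<^sub>R u j)"
  by (simp only: svd_part_def sum_matrix_vector_mult outer_mult)

lemma transpose_svd_part_mult:
  fixes X :: "real^'n^'m"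
  shows "transpose (svd_part X u J) *v x = (\<Sum>j\<in>J. (u j \<bullet> x) *\<^sub>R (transpose X *v u j))"
proof -
  have "transpose (svd_part X u J) = (\<Sum>j\<in>J. outer (transpose X *v u j) (u j))"
    unfolding svd_part_def
    by (induction J rule: infinite_finite_induct)
      (auto simp: transpose_add transpose_outer, auto simp: vec_eq_iff transpose_def)
  then show ?thesis by (simp only: sum_matrix_vector_mult outer_mult)
qed

text \<open>The basis \<open>u\<close> still diagonalises the Gram matrix of the truncation, with
  the eigenvalues outside \<open>J\<close> replaced by 0. They need not decrease, so the order-free
  formula is used.\<close>

lemma schatten_pow_svd_part:
  fixes X :: "real^'n^'m"
  assumes u: "left_singular_basis X u" and J: "J \<subseteq> {..<CARD('m)}"
  shows "schatten_pow p (svd_part X u J) = (\<Sum>j\<in>J. singular_value (Suc j) X powr p)"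
proof -
  let ?P = "svd_part X u J" and ?\<mu> = "\<lambda>j. if j \<in> J then (singular_value (Suc j) X)\<^sup>2 else 0"
  have on: "orthonormal_upto CARD('m) u" using left_singular_basis_orthonormal[OF u] .
  have fin: "finite J" using J finite_subset by blast
  have "?P *v (transpose ?P *v u i) = ?\<mu> i *\<^sub>R u i" if i: "i < CARD('m)" for i
  proof -
    have "transpose ?P *v u i = (\<Sum>j\<in>J. if j = i then transpose X *v u i else 0)"
      unfolding transpose_svd_part_mult using J i
      by (intro sum.cong) (auto simp: orthonormal_uptoD[OF on])
    then have P: "transpose ?P *v u i = (if i \<in> J then transpose X *v u i else 0)"
      using fin by simp
    have "?P *v (transpose X *v u i) = (\<Sum>j\<in>J. if j = i then (singular_value (Suc i) X)\<^sup>2 *\<^sub>R u i else 0)"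
      unfolding svd_part_mult using J i left_singular_basis_inner[OF u]
      by (intro sum.cong) auto
    then show ?thesis using fin by (simp only: P) auto
  qed
  then have "eigensystem ((*v) (?P ** transpose ?P)) u ?\<mu>"
    using on by (simp add: eigensystem_def matrix_vector_mul_assoc del: transpose_matrix_vector)
  then have "schatten_pow p ?P = (\<Sum>j<CARD('m). sqrt (?\<mu> j) powr p)"
    by (rule schatten_pow_eigensystem)
  \<comment> \<open>The removed terms vanish because \<open>0 powr p = 0\<close>.\<close>
  also have "\<dots> = (\<Sum>j<CARD('m). if j \<in> J then singular_value (Suc j) X powr p else 0)"
    by (rule sum.cong) (auto simp: singular_value_nonneg)
  also have "\<dots> = (\<Sum>j\<in>J. singular_value (Suc j) X powr p)"
    using J by (subst sum.inter_restrict[symmetric]) (auto simp: Int_absorb1)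
  finally show ?thesis .
qed

text \<open>The range lies in the span of the vectors \<open>u j\<close> with \<open>j\<close> in
  \<open>J\<close>.\<close>

lemma rank_svd_part:
  fixes X :: "real^'n^'m"
  assumes "finite J"
  shows "rank (svd_part X u J) \<le> card J"
proof -
  have "range ((*v) (svd_part X u J)) \<subseteq> span (u ` J)"
    unfolding svd_part_mult by (intro image_subsetI span_sum span_mul span_base imageI)
  then have "dim (range ((*v) (svd_part X u J))) \<le> card (u ` J)"
    using assms dim_le_card by blast
  also have "\<dots> \<le> card J" using assms by (rule card_image_le)
  finally show ?thesis by (simp add: rank_dim_range)
qed

section \<open>Exact recovery\<close>

text \<open>A feasible competitor that is not strictly worse than the minimiser \<open>X\<close>
  would be a minimiser itself, against uniqueness.\<close>

lemma exactly_recovered_iff: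
  "exactly_recovered p \<A> X \<longleftrightarrow> (\<forall>W. \<A> W = \<A> X \<and> W \<noteq> X \<longrightarrow> schatten_pow p X < schatten_pow p W)"
proof
  assume *: "exactly_recovered p \<A> X"
  then have X: "is_arg_min (schatten_pow p) (\<lambda>W. \<A> W = \<A> X) X"
    by (simp add: exactly_recovered_def optimal_solution_def)
  show "\<forall>W. \<A> W = \<A> X \<and> W \<noteq> X \<longrightarrow> schatten_pow p X < schatten_pow p W"
  proof (intro allI impI, rule ccontr)
    fix W assume W: "\<A> W = \<A> X \<and> W \<noteq> X" "\<not> schatten_pow p X < schatten_pow p W"
    then have "is_arg_min (schatten_pow p) (\<lambda>W. \<A> W = \<A> X) W"
      using X by (auto simp: is_arg_min_linorder)
    with * W(1) show False by (simp add: exactly_recovered_def optimal_solution_def)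
  qed
next
  assume *: "\<forall>W. \<A> W = \<A> X \<and> W \<noteq> X \<longrightarrow> schatten_pow p X < schatten_pow p W"
  then show "exactly_recovered p \<A> X"
    unfolding exactly_recovered_def optimal_solution_def is_arg_min_def
    by (metis less_asym less_irrefl)
qed

theorem proposition4:
  fixes p :: real and k :: nat and \<A> :: "real^'n^'m \<Rightarrow> real^'l"
  assumes "0 < p" and "p < 1"
    and "CARD('m) \<le> CARD('n)"
    and "1 \<le> k" and "k \<le> CARD('m)"
    and "linear \<A>"
  shows "(\<forall>X :: real^'n^'m. rank X \<le> k \<longrightarrow> exactly_recovered p \<A> X) \<longleftrightarrow>
    (\<forall>Z \<in> nullspace \<A> - {0}.
      (\<Sum>i = 1..k. singular_value i Z powr p) < (\<Sum>i = k+1..CARD('m). singular_value i Z powr p))"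
proof -
  interpret \<A>: linear \<A> by fact
  let ?f = "\<lambda>X j. singular_value (Suc j) (X :: real^'n^'m) powr p"
  have head: "(\<Sum>i = 1..k. singular_value i X powr p) = (\<Sum>j<k. ?f X j)" for X
    by (rule sum.reindex_bij_witness[of _ Suc "\<lambda>i. i - 1"]) auto
  have tail: "(\<Sum>i = k+1..CARD('m). singular_value i X powr p) = (\<Sum>j=k..<CARD('m). ?f X j)" for X
    by (rule sum.reindex_bij_witness[of _ Suc "\<lambda>i. i - 1"]) auto
  have split: "{..<CARD('m)} = {..<k} \<union> {k..<CARD('m)}" using \<open>k \<le> CARD('m)\<close> by auto
  have sum_split: "(\<Sum>j<CARD('m). g j) = (\<Sum>j<k. g j) + (\<Sum>j=k..<CARD('m). g j)" for g :: "nat \<Rightarrow> real"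
    unfolding split by (rule sum.union_disjoint) auto
  show ?thesis unfolding head tail
  proof (intro iffI allI ballI impI)
    fix Z assume rec: "\<forall>X. rank X \<le> k \<longrightarrow> exactly_recovered p \<A> X" and Z: "Z \<in> nullspace \<A> - {0}"
    obtain u where u: "left_singular_basis Z u" using singular_values by metis
    define X where "X = svd_part Z u {..<k}"
    \<comment> \<open>The sign makes \<open>X - W\<close> equal to \<open>Z\<close>, so that
      \<open>X\<close> and \<open>W\<close> have the same measurements; it leaves the singular
      values unchanged.\<close>
    define W where "W = - svd_part Z u {k..<CARD('m)}"
    have "X - W = svd_part Z u {..<CARD('m)}"
      unfolding W_def X_def svd_part_def split by (subst sum.union_disjoint) auto
    then have XW: "X - W = Z" by (simp add: svd_part_all[OF u])
    have "\<A> X - \<A> W = \<A> Z" by (simp add: XW flip: \<A>.diff)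
    then have "\<A> W = \<A> X" "W \<noteq> X" using Z XW by (auto simp: nullspace_def)
    moreover have "rank X \<le> k" unfolding X_def using rank_svd_part[of "{..<k}" Z u] by simp
    ultimately have "schatten_pow p X < schatten_pow p W"
      using rec unfolding exactly_recovered_iff by blast
    moreover have "schatten_pow p X = (\<Sum>j<k. ?f Z j)"
      unfolding X_def using \<open>k \<le> CARD('m)\<close> by (intro schatten_pow_svd_part[OF u]) auto
    moreover have "schatten_pow p W = (\<Sum>j=k..<CARD('m). ?f Z j)"
      using schatten_pow_svd_part[OF u, of "{k..<CARD('m)}"]
      by (simp add: W_def schatten_pow_def singular_value_uminus subset_eq)
    ultimately show "(\<Sum>j<k. ?f Z j) < (\<Sum>j=k..<CARD('m). ?f Z j)" by simp
  next
    fix X :: "real^'n^'m"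
    assume nsp: "\<forall>Z\<in>nullspace \<A> - {0}. (\<Sum>j<k. ?f Z j) < (\<Sum>j=k..<CARD('m). ?f Z j)"
      and X: "rank X \<le> k"
    have "schatten_pow p X < schatten_pow p W" if W: "\<A> W = \<A> X" "W \<noteq> X" for W
    proof -
      have "W - X \<in> nullspace \<A> - {0}" using W by (simp add: nullspace_def \<A>.diff)
      with nsp have Z: "(\<Sum>j<k. ?f (W - X) j) < (\<Sum>j=k..<CARD('m). ?f (W - X) j)" by blast
      have "?f (X - W) j = ?f (W - X) j" for j using singular_value_uminus[of _ "W - X"] by simp
      \<comment> \<open>The two matrices compared are \<open>X - W\<close> and \<open>X\<close>,
        whose difference is \<open>W\<close>.\<close>
      then have "(\<Sum>j<CARD('m). \<bar>?f (W - X) j - ?f X j\<bar>) \<le> schatten_pow p W"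
        using sum_powr_singular_value_diff[OF assms(1-3), of "X - W" X] by simp
      moreover have "(\<Sum>j<k. ?f X j - ?f (W - X) j) \<le> (\<Sum>j<k. \<bar>?f (W - X) j - ?f X j\<bar>)"
        by (rule sum_mono) linarith
      \<comment> \<open>Beyond \<open>k\<close> the singular values of \<open>X\<close> vanish, so
        the tail of the Mirsky sum is exactly the tail of \<open>W - X\<close>; by hypothesis it
        more than makes up for the head of \<open>W - X\<close> subtracted above.\<close>
      moreover have "(\<Sum>j=k..<CARD('m). ?f (W - X) j) = (\<Sum>j=k..<CARD('m). \<bar>?f (W - X) j - ?f X j\<bar>)"
        using X by (intro sum.cong) (auto simp: singular_value_eq_0)
      moreover have "schatten_pow p X = (\<Sum>j<k. ?f X j)"
        using X by (simp add: schatten_pow_lessThan sum_split singular_value_eq_0)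
      ultimately show ?thesis using Z by (simp add: sum_split sum_subtractf)
    qed
    then show "exactly_recovered p \<A> X" unfolding exactly_recovered_iff by blast
  qed
qed

end
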